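(* Let $k \ge 2$ and let $D_1,D_2,\ldots,D_k$ be oriented graphs. Assume that there is $j\in \{1,\dots,k\}$ such that $\mathrm{inv}(D_j)\ge 1$ and $\mathrm{inv}(D_i)=1$ for all $i \in \{1,\dots,k\}\setminus \{j\}$. Then $$\mathrm{inv}([D_1,D_2,\ldots,D_k])=\begin{cases} \sum_{i=1}^k \mathrm{inv}(D_i) -1 & \text{if } \mathrm{inv}(\overrightarrow{C_3} \Rightarrow D_j)=\mathrm{inv}(D_j),\\ \sum_{i=1}^k \mathrm{inv}(D_i) & \text{otherwise.}\end{cases}$$
   Context: All digraphs are finite and have no loops, parallel arcs or 2-cycles (i.e. they are oriented graphs). $\overrightarrow{C_3}$ denotes the directed cycle on three vertices. For a digraph $D$ with vertex set $V(D)$ and a subset $X\subseteq V(D)$, the inversion of $X$ in $D$ is the digraph $\mathrm{Inv}(D;X)$ obtained from $D$ by reversing the direction of all arcs with both ends in $X$. For a finite family $(X_i)_{i\in I}$ of subsets of $V(D)$, $\mathrm{Inv}(D;(X_i)_{i\in I})$ is obtained by inverting the sets $X_i$ one after another (the order does not matter). The family is a decycling family if $\mathrm{Inv}(D;(X_i)_{i\in I})$ is acyclic. The inversion number $\mathrm{inv}(D)$ is the minimum cardinality $|I|$ of a decycling family of $D$. For pairwise vertex-disjoint oriented graphs $D_1,\dots,D_k$, the $k$-join $[D_1,\dots,D_k]$ is the oriented graph obtained from the disjoint union of $D_1,\dots,D_k$ by adding all arcs $xy$ with $x\in V(D_i)$, $y\in V(D_j)$, $i<j$ (if the same graph occurs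 several times, disjoint copies are used). The dijoin is $L\Rightarrow R=[L,R]$. *)

theory Defs
  imports "Graph_Theory.Pair_Digraph"
begin

text \<open>Parallel arcs are excluded by the representation of arcs as pairs of vertices;
  finiteness and the absence of loops are part of \<open>pair_digraph\<close>.\<close>

locale oriented_graph = pair_digraph G for G :: "'a pair_pre_digraph" +
  assumes no_2_cycles: "(u, v) \<in> parcs G \<Longrightarrow> (v, u) \<notin> parcs G"

definition invert :: "'a set \<Rightarrow> 'a pair_pre_digraph \<Rightarrow> 'a pair_pre_digraph" where
  "invert X D = \<lparr> pverts = pverts D,
     parcs = {(u, v). (u, v) \<in> parcs D \<and> \<not> (u \<in> X \<and> v \<in> X)}
           \<union> {(v, u) | u v. (u, v) \<in> parcs D \<and> u \<in> X \<and> v \<in> X} \<rparr>"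

text \<open>A finite family \<open>(X\<^sub>i)\<close> is represented by a list, so that a set may occur repeatedly and
  the cardinality of the index set is the length of the list.\<close>

definition invert_family :: "'a set list \<Rightarrow> 'a pair_pre_digraph \<Rightarrow> 'a pair_pre_digraph" where
  "invert_family Xs D = fold invert Xs D"

definition decycling_family :: "'a pair_pre_digraph \<Rightarrow> 'a set list \<Rightarrow> bool" where
  "decycling_family D Xs \<longleftrightarrow>
     (\<forall>X \<in> set Xs. X \<subseteq> pverts D) \<and> acyclic (parcs (invert_family Xs D))"

text \<open>The minimum is attained for oriented graphs, see \<open>decycling_family_exists\<close> below.\<close>

definition inversion_number :: "'a pair_pre_digraph \<Rightarrow> nat" where
  "inversion_number D = (LEAST n. \<exists>Xs. decycling_family D Xs \<and> length Xs = n)"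

definition relabel :: "('a \<Rightarrow> 'b) \<Rightarrow> 'a pair_pre_digraph \<Rightarrow> 'b pair_pre_digraph" where
  "relabel f D = \<lparr> pverts = f ` pverts D, parcs = map_prod f f ` parcs D \<rparr>"

text \<open>The \<open>k\<close>-join of \<open>D 1, \<dots>, D k\<close>. The pair \<open>(i, x)\<close> is the vertex \<open>x\<close> of the copy of
  \<open>D i\<close>, which makes the copies vertex-disjoint.\<close>

definition kjoin :: "nat \<Rightarrow> (nat \<Rightarrow> 'a pair_pre_digraph) \<Rightarrow> (nat \<times> 'a) pair_pre_digraph" where
  "kjoin k D = \<lparr> pverts = (\<Union>i \<in> {1..k}. pverts (relabel (Pair i) (D i))),
     parcs = (\<Union>i \<in> {1..k}. parcs (relabel (Pair i) (D i)))
           \<union> {((i, x), (j, y)) | i j x y.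
                i \<in> {1..k} \<and> j \<in> {1..k} \<and> i < j \<and> x \<in> pverts (D i) \<and> y \<in> pverts (D j)} \<rparr>"

text \<open>\<open>Inl\<close> and \<open>Inr\<close> only bring \<open>L\<close> and \<open>R\<close>, whose vertex types may differ, to a common
  vertex type.\<close>

definition dijoin :: "'a pair_pre_digraph \<Rightarrow> 'b pair_pre_digraph \<Rightarrow> (nat \<times> ('a + 'b)) pair_pre_digraph" where
  "dijoin L R = kjoin 2 (\<lambda>i. if i = 1 then relabel Inl L else relabel Inr R)"

definition C3 :: "nat pair_pre_digraph" where
  "C3 = \<lparr> pverts = {0, 1, 2}, parcs = {(0, 1), (1, 2), (2, 0)} \<rparr>"

lemma oriented_graph_iff:
  "oriented_graph D \<longleftrightarrow> finite (pverts D) \<and> parcs D \<subseteq> pverts D \<times> pverts D \<and>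
     (\<forall>u v. (u, v) \<in> parcs D \<longrightarrow> u \<noteq> v \<and> (v, u) \<notin> parcs D)" (is "?L \<longleftrightarrow> ?R")
proof
  assume ?L
  then interpret oriented_graph D .
  have "parcs D \<subseteq> pverts D \<times> pverts D" by (auto dest: in_arcsD1 in_arcsD2)
  moreover have "u \<noteq> v" if "(u, v) \<in> parcs D" for u v
    using pair_no_loops[OF that] by simp
  ultimately show ?R using pair_finite_verts no_2_cycles by blast
next
  assume R: ?R
  then have "finite (parcs D)" using finite_subset by blast
  with R show ?L by unfold_locales auto
qed

lemma oriented_graph_C3: "oriented_graph C3"
  by (auto simp: oriented_graph_iff C3_def)

lemma oriented_graph_relabel: "inj f \<Longrightarrow> oriented_graph D \<Longrightarrow> oriented_graph (relabel f D)"
  unfolding oriented_graph_iff relabel_def by (auto simp: inj_eq)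

lemma oriented_graph_kjoin:
  assumes "\<And>i. i \<in> {1..k} \<Longrightarrow> oriented_graph (D i)"
  shows "oriented_graph (kjoin k D)"
proof -
  have D: "finite (pverts (D i))" "parcs (D i) \<subseteq> pverts (D i) \<times> pverts (D i)"
    "\<And>u. (u, u) \<notin> parcs (D i)" "\<And>u v. (u, v) \<in> parcs (D i) \<Longrightarrow> (v, u) \<notin> parcs (D i)"
    if "i \<in> {1..k}" for i
    using assms[OF that] unfolding oriented_graph_iff by blast+
  have "finite (pverts (kjoin k D))" using D(1) by (auto simp: kjoin_def relabel_def)
  moreover have "parcs (kjoin k D) \<subseteq> pverts (kjoin k D) \<times> pverts (kjoin k D)"
    using D(2) by (force simp: kjoin_def relabel_def)
  moreover have "u \<noteq> v \<and> (v, u) \<notin> parcs (kjoin k D)" if "(u, v) \<in> parcs (kjoin k D)" for u v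
    using that D(3,4) by (auto simp: kjoin_def relabel_def)
  ultimately show ?thesis unfolding oriented_graph_iff by blast
qed

lemma oriented_graph_dijoin:
  "oriented_graph L \<Longrightarrow> oriented_graph R \<Longrightarrow> oriented_graph (dijoin L R)"
  unfolding dijoin_def by (rule oriented_graph_kjoin) (auto intro: oriented_graph_relabel)

lemma oriented_graph_invert: "oriented_graph D \<Longrightarrow> oriented_graph (invert X D)"
  by (auto simp: oriented_graph_iff invert_def)

lemma decycling_family_exists:
  assumes "oriented_graph D"
  shows "\<exists>Xs. decycling_family D Xs"
proof -
  from assms obtain f :: "'a \<Rightarrow> nat" where f: "inj_on f (pverts D)"
    using finite_imp_inj_to_nat_seg by (metis oriented_graph_iff)
  define backward where "backward E = {(u, v) \<in> parcs E. f v < f u}" for E :: "'a pair_pre_digraph"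
  have "\<exists>Xs. decycling_family E Xs"
    if "oriented_graph E" "inj_on f (pverts E)" for E :: "'a pair_pre_digraph"
    using that
  proof (induction "card (backward E)" arbitrary: E rule: less_induct)
    case less
    from less.prems have E: "finite (pverts E)" "parcs E \<subseteq> pverts E \<times> pverts E"
      and irrefl: "\<And>u. (u, u) \<notin> parcs E"
      and asym: "\<And>u v. (u, v) \<in> parcs E \<Longrightarrow> (v, u) \<notin> parcs E"
      unfolding oriented_graph_iff by blast+
    have fin: "finite (backward E)"
      by (rule finite_subset[of _ "pverts E \<times> pverts E"]) (use E in \<open>auto simp: backward_def\<close>)
    show ?case
    proof (cases "backward E = {}")
      case True
      have "parcs E \<subseteq> measure f"
      proof (rule subrelI)
        fix u v assume "(u, v) \<in> parcs E"
        with True E irrefl have "u \<in> pverts E" "v \<in> pverts E" "u \<noteq> v" "\<not> f v < f u"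
          unfolding backward_def by blast+
        with less.prems(2) have "f u \<noteq> f v" by (simp add: inj_on_eq_iff)
        with \<open>\<not> f v < f u\<close> show "(u, v) \<in> measure f" by simp
      qed
      then have "acyclic (parcs E)"
        by (meson acyclic_subset wf_acyclic wf_measure)
      then have "decycling_family E []"
        by (simp add: decycling_family_def invert_family_def)
      then show ?thesis ..
    next
      case False
      then obtain u v where uv: "(u, v) \<in> parcs E" "f v < f u" unfolding backward_def by blast
      with E have V: "{u, v} \<subseteq> pverts E" by blast
      have "backward (invert {u, v} E) \<subseteq> backward E - {(u, v)}"
        using uv asym[OF uv(1)] by (auto simp: backward_def invert_def)
      moreover have "(u, v) \<in> backward E" using uv by (simp add: backward_def)
      ultimately have "card (backward (invert {u, v} E)) < card (backward E)"
        by (intro psubset_card_mono fin) auto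
      from less.hyps[OF this oriented_graph_invert[OF less.prems(1)]] less.prems(2)
      obtain Xs where "decycling_family (invert {u, v} E) Xs" by (auto simp: invert_def)
      with V have "decycling_family E ({u, v} # Xs)"
        by (auto simp: decycling_family_def invert_family_def invert_def)
      then show ?thesis ..
    qed
  qed
  with assms f show ?thesis by blast
qed

end

theory Submission
  imports Defs "HOL-Library.Z2"
begin

text \<open>
  Record a family of \<open>n\<close> sets by giving every vertex the vector over the field with two elements
  that lists its memberships. An arc is reversed exactly if the dot product of the vectors of its
  ends is 1, so the inversion number is the smallest dimension in which suitable vectors exist.

  Call a digraph \<^emph>\<open>critical\<close> if its inversion number \<open>n\<close> is odd and is attained by
  vectors that are orthogonal to themselves, that is, by sets that cover each vertex an even number
  of times. The all-one vector of odd length has square 1 and is orthogonal to such vectors, so it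
  can serve as the vector of one more set that lies in another part of a join. Hence a critical
  part can share its coordinates with one other part of inversion number 1
  (\<open>decyclable_join_padded\<close>). All remaining parts take one coordinate each.

  This is the only possible saving. Suppose that the first part of a join is not acyclic; the
  last part is treated by reversing all arcs. After the
  inversions it contains three vertices that were a cyclic triangle; in the final order they cut the
  remaining vertices into intervals, and the vectors of the triple represent the indicators of these
  intervals as linear functionals (\<open>decycles_beside_cyclic_triple\<close>). Orthogonal geometry then
  lets one reverse an interval (\<open>odd_interval_vector\<close>) or exchange two consecutive intervals
  (\<open>adjacent_isotropic_interval_vectors\<close>), in such a way that the new vectors of the remaining
  part are all orthogonal to a fixed nonzero vector. This saves a coordinate
  (\<open>drop_coordinate\<close>), unless the fixed vector is the all-one vector in odd dimension, in which
  case the remaining part is decycled by self-orthogonal vectors. So a part adds at least one to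
  the inversion number of a digraph that is not critical.

  The same geometry shows that if the join itself were decycled by self-orthogonal vectors in odd
  dimension, the rest would need two coordinates fewer. As each further part adds at most one, a
  join of at least two such parts is never critical. So a saving happens at most once, and it happens exactly if the part
  \<open>D j\<close> is critical (\<open>inversion_number_join\<close>). Applied to the join of \<open>C3\<close> and
  \<open>D j\<close>, the same formula says that \<open>D j\<close> is critical exactly if this join has the
  inversion number of \<open>D j\<close>.
\<close>

section \<open>Inversions as vectors over the field with two elements\<close>

text \<open>By default the arithmetic of \<open>bit\<close> is rewritten to Boolean connectives, which would
  hide the bilinearity of the dot product.\<close>

declare add_bit_eq_xor [simp del] mult_bit_eq_and [simp del]

definition dot :: "nat set \<Rightarrow> (nat \<Rightarrow> bit) \<Rightarrow> (nat \<Rightarrow> bit) \<Rightarrow> bit" where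
  "dot I x y = (\<Sum>i\<in>I. x i * y i)"

text \<open>The vector of a vertex lists the sets of the family that contain it, so the dot product of
  two vectors is the parity of the number of times that an arc between the two vertices is
  reversed. The witness carries a linear order along which all arcs point after the inversions:
  the arguments below reverse and exchange intervals of that order. Coordinates are indexed by an
  arbitrary finite set because they are dropped and appended one at a time.\<close>

definition decycles ::
  "'a pair_pre_digraph \<Rightarrow> nat set \<Rightarrow> ('a \<Rightarrow> nat \<Rightarrow> bit) \<Rightarrow> 'a rel \<Rightarrow> bool" where
  "decycles G I f r \<longleftrightarrow> finite I \<and> strict_linear_order_on (pverts G) r \<and>
     (\<forall>(u, v) \<in> parcs G. (u, v) \<in> r \<longleftrightarrow> dot I (f u) (f v) = 0)"

definition decyclable :: "'a pair_pre_digraph \<Rightarrow> nat \<Rightarrow> bool" where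
  "decyclable G n \<longleftrightarrow> (\<exists>I f r. decycles G I f r \<and> card I = n)"

text \<open>A vector is orthogonal to itself when the vertex lies in an even number of the sets.\<close>

definition isotropically_decyclable :: "'a pair_pre_digraph \<Rightarrow> nat \<Rightarrow> bool" where
  "isotropically_decyclable G n \<longleftrightarrow>
     (\<exists>I f r. decycles G I f r \<and> card I = n \<and> (\<forall>u \<in> pverts G. dot I (f u) (f u) = 0))"

text \<open>These are the digraphs for which a join with one further digraph of inversion number 1 costs
  no additional inversion: if the dimension is odd and all vectors are self-orthogonal, then the
  all-one vector has square 1 and is orthogonal to every vector in use.\<close>

definition critical :: "'a pair_pre_digraph \<Rightarrow> bool" where
  "critical G \<longleftrightarrow> odd (inversion_number G) \<and> isotropically_decyclable G (inversion_number G)"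

lemma dot_commute: "dot I x y = dot I y x"
  by (simp only: dot_def mult.commute)

lemma dot_add_scaled_left: "dot I (\<lambda>i. x i + c * y i) z = dot I x z + c * dot I y z"
  by (simp only: dot_def distrib_right sum.distrib sum_distrib_left mult.assoc)

lemma dot_add_scaled_right: "dot I z (\<lambda>i. x i + c * y i) = dot I z x + c * dot I z y"
  using dot_add_scaled_left[of I x c y z] by (simp only: dot_commute[of I z])

lemma dot_add_left: "dot I (\<lambda>i. x i + y i) z = dot I x z + dot I y z"
  using dot_add_scaled_left[of I x 1 y z] by (simp only: mult_1)

lemma dot_add_right: "dot I z (\<lambda>i. x i + y i) = dot I z x + dot I z y"
  using dot_add_scaled_right[of I z x 1 y] by (simp only: mult_1)

lemma dot_scaled_left: "dot I (\<lambda>t. c * x t) y = c * dot I x y"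
  by (simp only: dot_def sum_distrib_left mult.assoc)

lemma dot_scaled_right: "dot I y (\<lambda>t. c * x t) = c * dot I y x"
  by (simp only: dot_commute[of I y] dot_scaled_left)

text \<open>Squaring is the identity on the field with two elements. Hence the map sending a vector to
  its dot product with itself is linear, being the product with the all-one vector.\<close>

lemma dot_self: "dot I x x = dot I (\<lambda>_. 1) x"
proof -
  have "x i * x i = x i" for i by (cases "x i") auto
  then show ?thesis by (simp only: dot_def mult_1)
qed

lemma bit_add_self: "x + x = (0::bit)"
  by (cases x) auto

lemma sum_of_ones: "(\<Sum>i\<in>I. 1 :: bit) = of_bool (odd (card I))"
  by (simp add: of_nat_of_bool) (cases "even (card I)"; auto elim!: evenE oddE)

lemma strict_linear_order_asym:
  assumes "strict_linear_order_on A r" "(u, v) \<in> r" shows "(v, u) \<notin> r"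
  using assms unfolding strict_linear_order_on_def irrefl_def by (meson transD)

text \<open>Vertices are ranked by their number of predecessors; ties are broken by an injection into
  the natural numbers.\<close>

lemma acyclic_extends_to_strict_linear_order:
  assumes "finite V" "A \<subseteq> V \<times> V" "acyclic A"
  shows "\<exists>r. strict_linear_order_on V r \<and> A \<subseteq> r"
proof -
  obtain g :: "'a \<Rightarrow> nat" where g: "inj_on g V"
    using finite_imp_inj_to_nat_seg[OF assms(1)] by metis
  define h where "h u = card {w \<in> V. (w, u) \<in> A\<^sup>+}" for u
  define r where "r = inv_image (less_than <*lex*> less_than) (\<lambda>u. (h u, g u))"
  have "h u < h v" if "(u, v) \<in> A" for u v
    unfolding h_def
  proof (rule psubset_card_mono)
    show "finite {w \<in> V. (w, v) \<in> A\<^sup>+}" using assms(1) by simp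
    have "(u, u) \<notin> A\<^sup>+" using assms(3) by (simp add: acyclic_def)
    moreover have "u \<in> V" using that assms(2) by blast
    ultimately show "{w \<in> V. (w, u) \<in> A\<^sup>+} \<subset> {w \<in> V. (w, v) \<in> A\<^sup>+}"
      using that by (auto intro: trancl_into_trancl)
  qed
  then have "A \<subseteq> r" unfolding r_def by auto
  moreover have "strict_linear_order_on V r"
    unfolding strict_linear_order_on_def
  proof (intro conjI)
    show "trans r" unfolding r_def by (intro trans_inv_image trans_lex_prod trans_less_than)
    show "irrefl r" unfolding r_def by (auto simp: irrefl_def)
    show "total_on V r" using g unfolding r_def total_on_def inj_on_def by (auto; metis nat_neq_iff)
  qed
  ultimately show ?thesis by blast
qed

lemma parcs_invert_family:
  "(u, v) \<in> parcs (invert_family Xs D) \<longleftrightarrow>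
     (if (\<Sum>X\<leftarrow>Xs. of_bool (u \<in> X \<and> v \<in> X) :: bit) = 0 then (u, v) else (v, u)) \<in> parcs D"
proof (induction Xs arbitrary: D)
  case Nil
  then show ?case by (simp add: invert_family_def)
next
  case (Cons X Xs)
  have "(u, v) \<in> parcs (invert_family (X # Xs) D) \<longleftrightarrow>
     (u, v) \<in> parcs (invert_family Xs (invert X D))" by (simp add: invert_family_def)
  also have "\<dots> \<longleftrightarrow> (if (\<Sum>X\<leftarrow>Xs. of_bool (u \<in> X \<and> v \<in> X) :: bit) = 0 then (u, v) else (v, u))
     \<in> parcs (invert X D)" by (rule Cons.IH)
  finally show ?case by (auto simp: invert_def)
qed

lemma decyclable_iff_decycling_family:
  assumes "oriented_graph D"
  shows "decyclable D n \<longleftrightarrow> (\<exists>Xs. decycling_family D Xs \<and> length Xs = n)"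
proof
  have fin: "finite (pverts D)" and sub: "parcs D \<subseteq> pverts D \<times> pverts D"
    and irr: "\<And>u. (u, u) \<notin> parcs D"
    using assms unfolding oriented_graph_iff by blast+
  {
    assume "\<exists>Xs. decycling_family D Xs \<and> length Xs = n"
    then obtain Xs where Xs: "decycling_family D Xs" "length Xs = n" by blast
    define f where "f u i = (of_bool (u \<in> Xs ! i) :: bit)" for u i
    let ?A = "parcs (invert_family Xs D)"
    have dot: "dot {..<n} (f u) (f v) = (\<Sum>X\<leftarrow>Xs. of_bool (u \<in> X \<and> v \<in> X))" for u v
      unfolding dot_def f_def of_bool_conj[symmetric] using Xs(2)
      by (simp add: sum_list_sum_nth atLeast0LessThan)
    have A: "(u, v) \<in> ?A \<longleftrightarrow> (if dot {..<n} (f u) (f v) = 0 then (u, v) else (v, u)) \<in> parcs D"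
      for u v unfolding dot by (rule parcs_invert_family)
    have "?A \<subseteq> pverts D \<times> pverts D" using sub by (auto simp: A split: if_splits)
    moreover have "acyclic ?A" using Xs(1) by (simp add: decycling_family_def)
    ultimately obtain r where r: "strict_linear_order_on (pverts D) r" "?A \<subseteq> r"
      using acyclic_extends_to_strict_linear_order[OF fin] by blast
    have "(u, v) \<in> r \<longleftrightarrow> dot {..<n} (f u) (f v) = 0" if "(u, v) \<in> parcs D" for u v
    proof (cases "dot {..<n} (f u) (f v) = 0")
      case True
      then have "(u, v) \<in> ?A" using that by (simp add: A)
      then show ?thesis using r True by blast
    next
      case False
      then have "dot {..<n} (f v) (f u) \<noteq> 0" by (simp add: dot_commute)
      then have "(v, u) \<in> r" using A[of v u] that r(2) by auto
      then show ?thesis using strict_linear_order_asym[OF r(1)] False by blast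
    qed
    then have "decycles D {..<n} f r" using r(1) by (auto simp: decycles_def)
    then show "decyclable D n" unfolding decyclable_def by (intro exI conjI) auto
  next
    assume "decyclable D n"
    then obtain I f r where d: "decycles D I f r" "card I = n" unfolding decyclable_def by blast
    then have I: "finite I" and r: "strict_linear_order_on (pverts D) r"
      and arc: "\<And>u v. (u, v) \<in> parcs D \<Longrightarrow> (u, v) \<in> r \<longleftrightarrow> dot I (f u) (f v) = 0"
      by (auto simp: decycles_def)
    define Xs where "Xs = map (\<lambda>i. {u \<in> pverts D. f u i = 1}) (sorted_list_of_set I)"
    have len: "length Xs = n" using d(2) I by (simp add: Xs_def)
    have dot: "(\<Sum>X\<leftarrow>Xs. of_bool (u \<in> X \<and> v \<in> X) :: bit) = dot I (f u) (f v)"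
      if "u \<in> pverts D" "v \<in> pverts D" for u v
    proof -
      have "(\<Sum>X\<leftarrow>Xs. of_bool (u \<in> X \<and> v \<in> X) :: bit) = (\<Sum>i\<in>I. of_bool (f u i = 1 \<and> f v i = 1))"
        unfolding Xs_def using I that
        by (simp add: comp_def sum_list_distinct_conv_sum_set)
      also have "\<dots> = (\<Sum>i\<in>I. f u i * f v i)"
      proof (rule sum.cong)
        show "of_bool (f u i = 1 \<and> f v i = 1) = f u i * f v i" for i
          by (cases "f u i"; cases "f v i") simp_all
      qed simp
      finally show ?thesis by (simp only: dot_def)
    qed
    have "parcs (invert_family Xs D) \<subseteq> r"
    proof (rule subrelI)
      fix u v assume "(u, v) \<in> parcs (invert_family Xs D)"
      then have uv: "(if (\<Sum>X\<leftarrow>Xs. of_bool (u \<in> X \<and> v \<in> X) :: bit) = 0 then (u, v) else (v, u))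
          \<in> parcs D" by (simp only: parcs_invert_family)
      then have V: "u \<in> pverts D" "v \<in> pverts D" using sub by (auto split: if_splits)
      have uv: "(if dot I (f u) (f v) = 0 then (u, v) else (v, u)) \<in> parcs D"
        using uv unfolding dot[OF V] .
      show "(u, v) \<in> r"
      proof (cases "dot I (f u) (f v) = 0")
        case True
        then show ?thesis using uv arc by simp
      next
        case False
        then have "(v, u) \<in> parcs D" "(v, u) \<notin> r" using uv arc[of v u] by (auto simp: dot_commute)
        moreover have "u \<noteq> v" using calculation(1) irr by blast
        ultimately show ?thesis
          using r V unfolding strict_linear_order_on_def total_on_def by blast
      qed
    qed
    then have "acyclic (parcs (invert_family Xs D))"
      using r unfolding strict_linear_order_on_def
      by (metis acyclic_irrefl acyclic_subset trancl_id)
    then have "decycling_family D Xs" by (auto simp: decycling_family_def Xs_def)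
    then show "\<exists>Xs. decycling_family D Xs \<and> length Xs = n" using len by blast
  }
qed

lemma inversion_number_eq_Least:
  "oriented_graph D \<Longrightarrow> inversion_number D = (LEAST n. decyclable D n)"
  by (simp add: inversion_number_def decyclable_iff_decycling_family)

lemma decyclable_inversion_number:
  assumes "oriented_graph D" shows "decyclable D (inversion_number D)"
  using decycling_family_exists[OF assms] decyclable_iff_decycling_family[OF assms]
  by (metis LeastI inversion_number_eq_Least[OF assms])

lemma inversion_number_le:
  "oriented_graph D \<Longrightarrow> decyclable D n \<Longrightarrow> inversion_number D \<le> n"
  by (simp add: inversion_number_eq_Least Least_le)

lemma isotropically_decyclable_imp_decyclable:
  "isotropically_decyclable G n \<Longrightarrow> decyclable G n"
  unfolding isotropically_decyclable_def decyclable_def by blast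

text \<open>Decycling families restrict along embeddings. This covers subgraphs, relabelled copies and
  the parts of a join.\<close>

lemma decycles_pullback:
  assumes "decycles H I f r" "inj_on h (pverts G)" "h ` pverts G \<subseteq> pverts H"
    "\<And>u v. (u, v) \<in> parcs G \<Longrightarrow> (h u, h v) \<in> parcs H"
  shows "decycles G I (f \<circ> h) (inv_image r h)"
proof -
  have H: "finite I" "trans r" "irrefl r" "total_on (pverts H) r"
    "\<And>u v. (u, v) \<in> parcs H \<Longrightarrow> (u, v) \<in> r \<longleftrightarrow> dot I (f u) (f v) = 0"
    using assms(1) by (auto simp: decycles_def strict_linear_order_on_def)
  have "total_on (pverts G) (inv_image r h)"
  proof (rule total_onI)
    fix u v assume "u \<in> pverts G" "v \<in> pverts G" "u \<noteq> v"
    then have "h u \<in> pverts H" "h v \<in> pverts H" "h u \<noteq> h v"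
      using assms(2,3) by (auto simp: inj_on_eq_iff)
    then show "(u, v) \<in> inv_image r h \<or> (v, u) \<in> inv_image r h"
      using H(4) by (auto simp: total_on_def)
  qed
  moreover have "irrefl (inv_image r h)" using H(3) by (simp add: irrefl_def)
  ultimately show ?thesis
    using H(1,2,5) assms(4) by (auto simp: decycles_def strict_linear_order_on_def trans_inv_image)
qed

lemma decyclable_pullback:
  assumes "inj_on h (pverts G)" "h ` pverts G \<subseteq> pverts H"
    "\<And>u v. (u, v) \<in> parcs G \<Longrightarrow> (h u, h v) \<in> parcs H"
  shows "decyclable H n \<Longrightarrow> decyclable G n"
    and "isotropically_decyclable H n \<Longrightarrow> isotropically_decyclable G n"
proof -
  show "decyclable G n" if "decyclable H n"
    using that decycles_pullback[OF _ assms] unfolding decyclable_def by blast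
  assume "isotropically_decyclable H n"
  then obtain I f r where "decycles H I f r" "card I = n" "\<forall>u \<in> pverts H. dot I (f u) (f u) = 0"
    unfolding isotropically_decyclable_def by blast
  moreover from this(3) assms(2) have "\<forall>u \<in> pverts G. dot I ((f \<circ> h) u) ((f \<circ> h) u) = 0"
    by auto
  ultimately show "isotropically_decyclable G n"
    using decycles_pullback[OF _ assms] unfolding isotropically_decyclable_def by blast
qed

lemma relabel_invariant:
  assumes "oriented_graph G" "inj h"
  shows "inversion_number (relabel h G) = inversion_number G"
    and "critical (relabel h G) \<longleftrightarrow> critical G"
proof -
  have to_relabel: "inj_on h (pverts G)" "h ` pverts G \<subseteq> pverts (relabel h G)"
    "\<And>u v. (u, v) \<in> parcs G \<Longrightarrow> (h u, h v) \<in> parcs (relabel h G)"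
    using assms(2) by (auto simp: relabel_def intro: inj_on_subset)
  have from_relabel: "inj_on (inv h) (pverts (relabel h G))" "inv h ` pverts (relabel h G) \<subseteq> pverts G"
    "\<And>u v. (u, v) \<in> parcs (relabel h G) \<Longrightarrow> (inv h u, inv h v) \<in> parcs G"
    using assms(2) by (auto simp: relabel_def inj_on_def)
  have eq: "decyclable (relabel h G) = decyclable G"
    "isotropically_decyclable (relabel h G) = isotropically_decyclable G"
    using decyclable_pullback[OF to_relabel] decyclable_pullback[OF from_relabel] by blast+
  show "inversion_number (relabel h G) = inversion_number G"
    using assms by (simp add: inversion_number_eq_Least oriented_graph_relabel eq)
  then show "critical (relabel h G) \<longleftrightarrow> critical G" by (simp add: critical_def eq)
qed

section \<open>Saving a coordinate\<close>

lemma dot_remove: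
  assumes "finite I" "i \<in> I" "x i = 0"
  shows "dot (I - {i}) x y = dot I x y"
  using assms by (simp add: dot_def sum.remove)

text \<open>Suppose that a vector \<open>p\<close> is orthogonal to all vectors in use. Adding to each
  \<open>f u\<close> the multiple \<open>f u k\<close> of a vector \<open>w\<close> with \<open>w k = 1\<close> clears the
  coordinate \<open>k\<close>; the correction terms in the dot products must cancel. If \<open>p\<close> is
  isotropic, then \<open>w = p\<close> works, since every term vanishes. Otherwise \<open>w\<close> is the sum of
  \<open>p\<close> and the unit vector of a coordinate \<open>k\<close> outside the support of \<open>p\<close>: this
  \<open>w\<close> is isotropic, its product with \<open>f u\<close> is \<open>f u k\<close>, and the two mixed terms are
  equal. Only the all-one vector in odd dimension admits neither choice.\<close>

lemma drop_coordinate: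
  assumes G: "oriented_graph G" and d: "decycles G I f r" and perp: "\<And>u. u \<in> pverts G \<Longrightarrow> dot I p (f u) = 0"
    and p: "i \<in> I" "p i = 1" "dot I p p = 0 \<or> (\<exists>i \<in> I. p i = 0)"
  obtains I' f' where "decycles G I' f' r" "card I' + 1 = card I"
    "\<And>u v. u \<in> pverts G \<Longrightarrow> v \<in> pverts G \<Longrightarrow> dot I' (f' u) (f' v) = dot I (f u) (f v)"
proof -
  have I: "finite I" using d by (simp add: decycles_def)
  obtain k w where k: "k \<in> I" "w k = 1"
    and w: "\<And>u v. u \<in> pverts G \<Longrightarrow> v \<in> pverts G \<Longrightarrow>
        f v k * dot I (f u) w + f u k * dot I w (f v) + f u k * f v k * dot I w w = 0"
  proof (cases "dot I p p = 0")
    case True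
    then show ?thesis using that[of i p] p(1,2) perp by (simp add: dot_commute)
  next
    case False
    then obtain k where k: "k \<in> I" "p k = 0" using p(3) by blast
    \<comment> \<open>the unit vector of the coordinate \<open>k\<close>\<close>
    define e where "e j = (of_bool (j = k) :: bit)" for j
    have e: "dot I e x = x k" for x
    proof -
      have "dot I e x = (\<Sum>j\<in>I. if j = k then x j else 0)"
        unfolding dot_def e_def by (intro sum.cong) auto
      then show ?thesis using I k(1) by simp
    qed
    let ?w = "\<lambda>j. p j + e j"
    have pp: "dot I p p = 1" using False by simp
    have ww: "dot I ?w ?w = 0"
      by (simp add: dot_add_left dot_add_right e pp dot_commute[of I p e] k(2)) (simp add: e_def)
    have "dot I ?w (f u) = f u k" if "u \<in> pverts G" for u
      by (simp add: dot_add_left e perp that)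
    moreover have "?w k = 1" using k(2) by (simp add: e_def)
    ultimately show ?thesis
      using that[of k ?w] k(1) ww by (simp add: dot_commute[of I "f _" ?w] bit_add_self mult.commute)
  qed
  define f' where "f' u j = f u j + f u k * w j" for u j
  have f'k: "f' u k = 0" for u by (simp add: f'_def k bit_add_self)
  have iso: "dot (I - {k}) (f' u) (f' v) = dot I (f u) (f v)"
    if "u \<in> pverts G" "v \<in> pverts G" for u v
  proof -
    have "dot (I - {k}) (f' u) (f' v) = dot I (f' u) (f' v)"
      using dot_remove[OF I k(1), of "f' u"] f'k by simp
    also have "\<dots> = dot I (f u) (f v) +
        (f v k * dot I (f u) w + f u k * dot I w (f v) + f u k * f v k * dot I w w)"
      unfolding f'_def dot_add_scaled_left dot_add_scaled_right by (simp only: algebra_simps)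
    finally show ?thesis using w[OF that] by simp
  qed
  show ?thesis
  proof (rule that[of "I - {k}" f'])
    show "decycles G (I - {k}) f' r"
    proof -
      have "dot (I - {k}) (f' u) (f' v) = dot I (f u) (f v)" if "(u, v) \<in> parcs G" for u v
        using that G iso by (auto simp: oriented_graph_iff)
      then show ?thesis using d unfolding decycles_def by auto
    qed
    show "card (I - {k}) + 1 = card I" using I k(1) by (metis Suc_eq_plus1 card_Suc_Diff1)
  qed (rule iso)
qed

section \<open>Rearranging intervals of the order\<close>

text \<open>Changing the dot products on the pairs in \<open>X\<close> reverses exactly the arcs between
  these pairs, so the order has to be reversed there too; it is only left to know that the result
  is transitive.\<close>

lemma decycles_flip:
  assumes G: "oriented_graph G" and d: "decycles G I f r"
    and dot': "\<And>u v. u \<in> pverts G \<Longrightarrow> v \<in> pverts G \<Longrightarrow>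
      dot I (f' u) (f' v) = dot I (f u) (f v) + of_bool (X u v)"
    and sym: "\<And>u v. X u v \<Longrightarrow> X v u"
    and r': "r' = {(u, v). u \<in> pverts G \<and> v \<in> pverts G \<and> (if X u v then (v, u) else (u, v)) \<in> r}"
    and trans: "trans r'"
  shows "decycles G I f' r'"
proof -
  let ?V = "pverts G"
  have r: "finite I" "irrefl r" "total_on ?V r" "strict_linear_order_on ?V r"
    and rd: "\<And>u v. (u, v) \<in> parcs G \<Longrightarrow> (u, v) \<in> r \<longleftrightarrow> dot I (f u) (f v) = 0"
    using d by (auto simp: decycles_def strict_linear_order_on_def)
  have "irrefl r'" using r(2) by (auto simp: irrefl_def r')
  moreover have "total_on ?V r'" using r(3) sym by (auto simp: total_on_def r')
  moreover have "(u, v) \<in> r' \<longleftrightarrow> dot I (f' u) (f' v) = 0" if "(u, v) \<in> parcs G" for u v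
  proof -
    have V: "u \<in> ?V" "v \<in> ?V" "u \<noteq> v" using that G by (auto simp: oriented_graph_iff)
    have "(v, u) \<in> r \<longleftrightarrow> (u, v) \<notin> r"
      using r(3) V strict_linear_order_asym[OF r(4)] by (auto simp: total_on_def)
    then show ?thesis
      using rd[OF that] V dot'[OF V(1,2)] by (auto simp: r' bit_add_self)
  qed
  ultimately show ?thesis
    using r(1) trans by (auto simp: decycles_def strict_linear_order_on_def)
qed

text \<open>Let \<open>p\<close> have square 1 and let the product with \<open>p\<close> be the indicator of an interval
  \<open>J\<close> of the order. The transvection along \<open>p\<close> changes the dot products exactly within
  \<open>J\<close>, and reversing an interval of a linear order leaves a linear order. Afterwards all
  vectors are orthogonal to \<open>p\<close>. If \<open>p\<close> misses a coordinate, one coordinate can be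
  saved; if \<open>p\<close> is the all-one vector, its square 1 says that the dimension is odd, and
  orthogonality to \<open>p\<close> is isotropy.\<close>

lemma odd_interval_vector:
  assumes G: "oriented_graph G" and d: "decycles G I f r"
    and J: "J \<subseteq> pverts G"
      "\<And>u v w. u \<in> J \<Longrightarrow> w \<in> J \<Longrightarrow> v \<in> pverts G \<Longrightarrow> (u, v) \<in> r \<Longrightarrow> (v, w) \<in> r \<Longrightarrow> v \<in> J"
    and p: "\<And>u. u \<in> pverts G \<Longrightarrow> dot I p (f u) = of_bool (u \<in> J)" "dot I p p = 1"
  shows "(\<exists>n. card I = n + 1 \<and> decyclable G n) \<or> odd (card I) \<and> isotropically_decyclable G (card I)"
proof -
  let ?V = "pverts G"
  have r: "strict_linear_order_on ?V r" "trans r" "irrefl r" "total_on ?V r"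
    using d by (auto simp: decycles_def strict_linear_order_on_def)
  define f' where "f' u j = f u j + of_bool (u \<in> J) * p j" for u j
  define r' where "r' = {(u, v). u \<in> ?V \<and> v \<in> ?V \<and>
     (if u \<in> J \<and> v \<in> J then (v, u) else (u, v)) \<in> r}"
  have perp: "dot I p (f' u) = 0" if "u \<in> ?V" for u
    unfolding f'_def dot_add_scaled_right using that p by (simp add: bit_add_self)
  have "trans r'"
  proof (rule transI)
    fix x y z assume xyz: "(x, y) \<in> r'" "(y, z) \<in> r'"
    then have V: "x \<in> ?V" "y \<in> ?V" "z \<in> ?V" by (auto simp: r'_def)
    show "(x, z) \<in> r'"
    proof (cases "x \<in> J \<and> y \<in> J \<and> z \<notin> J \<or> x \<notin> J \<and> y \<in> J \<and> z \<in> J")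
      case True
      \<comment> \<open>one end of the path lies outside \<open>J\<close>; convexity fixes its position relative to the other two\<close>
      then have "(z, x) \<notin> r" "z \<noteq> x" using xyz J(2)[of y x z] J(2)[of z y x] V
        by (auto simp: r'_def)
      then show ?thesis using r(4) True V by (auto simp: r'_def total_on_def)
    next
      case False
      have "\<not> (x \<in> J \<and> y \<notin> J \<and> z \<in> J)" using xyz J(2)[of x z y] V by (auto simp: r'_def)
      then show ?thesis using xyz V False transD[OF r(2), of x y z] transD[OF r(2), of z y x]
        by (auto simp: r'_def split: if_splits)
    qed
  qed
  moreover have "dot I (f' u) (f' v) = dot I (f u) (f v) + of_bool (u \<in> J \<and> v \<in> J)"
    if "u \<in> ?V" "v \<in> ?V" for u v
    unfolding f'_def dot_add_scaled_left dot_add_scaled_right using that p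
    by (auto simp: dot_commute[of I "f u" p] bit_add_self)
  ultimately have d': "decycles G I f' r'"
    by (intro decycles_flip[OF G d _ _ r'_def]) auto
  show ?thesis
  proof (cases "\<exists>i\<in>I. p i = 0")
    case True
    have "\<exists>i\<in>I. p i = 1"
    proof (rule ccontr)
      assume "\<not> ?thesis"
      then have "dot I p p = 0" by (auto simp: dot_def intro!: sum.neutral)
      then show False using p(2) by simp
    qed
    then show ?thesis
      using drop_coordinate[OF G d' perp] True unfolding decyclable_def
      by metis
  next
    case False
    then have ones: "dot I p x = dot I (\<lambda>_. 1) x" for x
      by (auto simp: dot_def intro!: sum.cong)
    have "dot I (f' u) (f' u) = 0" if "u \<in> ?V" for u
      using perp[OF that] by (simp add: dot_self ones)
    moreover have "odd (card I)"
      using p(2) ones[of p] False sum_of_ones[of I] by (simp add: dot_def split: if_splits)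
    ultimately show ?thesis using d' unfolding isotropically_decyclable_def by blast
  qed
qed

text \<open>Let \<open>p\<close> and \<open>q\<close> be isotropic with product 1, representing consecutive intervals
  \<open>J\<close> and \<open>K\<close>. Adding \<open>q\<close> on \<open>J\<close> and \<open>p\<close> on \<open>K\<close> changes the dot products
  exactly between \<open>J\<close> and \<open>K\<close>, which corresponds to exchanging the two intervals. Afterwards
  all vectors are orthogonal to the isotropic vector \<open>p\<close>, and one coordinate can be saved. If all
  vectors were isotropic, they remain so and are orthogonal to the all-one vector; when the
  dimension was odd it is now even, the all-one vector is isotropic as well, and a second
  coordinate can be saved.\<close>

lemma adjacent_isotropic_interval_vectors:
  assumes G: "oriented_graph G" and d: "decycles G I f r"
    and JK: "J \<subseteq> pverts G" "K \<subseteq> pverts G" "\<And>u v. u \<in> J \<Longrightarrow> v \<in> K \<Longrightarrow> (u, v) \<in> r"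
      "\<And>u v w. u \<in> J \<Longrightarrow> w \<in> K \<Longrightarrow> v \<in> pverts G \<Longrightarrow> (u, v) \<in> r \<Longrightarrow> (v, w) \<in> r \<Longrightarrow> v \<in> J \<union> K"
    and p: "\<And>u. u \<in> pverts G \<Longrightarrow> dot I p (f u) = of_bool (u \<in> J)" "dot I p p = 0"
    and q: "\<And>u. u \<in> pverts G \<Longrightarrow> dot I q (f u) = of_bool (u \<in> K)" "dot I q q = 0"
    and pq: "dot I p q = 1"
  shows "\<exists>n. card I = n + 1 \<and> decyclable G n"
    and "odd (card I) \<Longrightarrow> (\<And>u. u \<in> pverts G \<Longrightarrow> dot I (f u) (f u) = 0) \<Longrightarrow>
      (\<exists>n. card I = n + 2 \<and> decyclable G n)"
proof -
  let ?V = "pverts G"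
  have r: "finite I" "strict_linear_order_on ?V r" "trans r" "irrefl r" "total_on ?V r"
    using d by (auto simp: decycles_def strict_linear_order_on_def)
  note asym = strict_linear_order_asym[OF r(2)]
  define f' where "f' u j = (f u j + of_bool (u \<in> J) * q j) + of_bool (u \<in> K) * p j" for u j
  define X where "X u v \<longleftrightarrow> u \<in> J \<and> v \<in> K \<or> u \<in> K \<and> v \<in> J" for u v
  define r' where "r' = {(u, v). u \<in> ?V \<and> v \<in> ?V \<and> (if X u v then (v, u) else (u, v)) \<in> r}"
  have disj: "u \<notin> K" if "u \<in> J" for u using JK(3)[OF that, of u] r(4) by (auto simp: irrefl_def)
  have perp: "dot I p (f' u) = 0" if "u \<in> ?V" for u
    unfolding f'_def dot_add_scaled_right using that p pq by (simp add: bit_add_self)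
  have dot': "dot I (f' u) (f' v) = dot I (f u) (f v) + of_bool (X u v)"
    if "u \<in> ?V" "v \<in> ?V" for u v
    unfolding f'_def dot_add_scaled_left dot_add_scaled_right using that p q pq disj
    by (auto simp: dot_commute[of I "f u" p] dot_commute[of I "f u" q] dot_commute[of I q p]
        bit_add_self X_def)
  have r': "(x, y) \<in> r' \<longleftrightarrow> x \<in> ?V \<and> y \<in> ?V \<and> (x \<in> K \<and> y \<in> J \<or> (x, y) \<in> r \<and> \<not> (x \<in> J \<and> y \<in> K))"
    for x y
    using JK(3) asym disj unfolding r'_def X_def by auto
  have tot: "u = v \<or> (u, v) \<in> r \<or> (v, u) \<in> r" if "u \<in> ?V" "v \<in> ?V" for u v
    using r(5) that by (auto simp: total_on_def)
  have "trans r'"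
  proof (rule transI)
    fix x y z assume xyz: "(x, y) \<in> r'" "(y, z) \<in> r'"
    then have V: "x \<in> ?V" "y \<in> ?V" "z \<in> ?V" by (auto simp: r')
    consider "x \<in> K" "y \<in> J" "(y, z) \<in> r" "z \<notin> K"
      | "y \<in> K" "z \<in> J" "(x, y) \<in> r" "x \<notin> J"
      | "(x, y) \<in> r" "(y, z) \<in> r" "\<not> (x \<in> J \<and> y \<in> K)" "\<not> (y \<in> J \<and> z \<in> K)"
      using xyz disj unfolding r' by blast
    then show "(x, z) \<in> r'"
    proof cases
      case 1
      then show ?thesis using JK(4)[of y x z] tot[OF V(1,3)] V disj by (auto simp: r')
    next
      case 2
      then show ?thesis using JK(4)[of z y x] tot[OF V(1,3)] V disj by (auto simp: r')
    next
      case 3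
      then show ?thesis
        using JK(4)[of x z y] transD[OF r(3) 3(1,2)] V by (auto simp: r')
    qed
  qed
  then have d': "decycles G I f' r'"
    by (intro decycles_flip[OF G d dot' _ r'_def]) (auto simp: X_def)
  have "\<exists>i\<in>I. p i = 1 \<and> q i = 1"
  proof (rule ccontr)
    assume "\<not> ?thesis"
    then have "dot I p q = 0" by (auto simp: dot_def intro!: sum.neutral)
    then show False using pq by simp
  qed
  then obtain i where i: "i \<in> I" "p i = 1" by blast
  obtain I' g where g: "decycles G I' g r'" "card I' + 1 = card I"
    and iso: "\<And>u v. u \<in> ?V \<Longrightarrow> v \<in> ?V \<Longrightarrow> dot I' (g u) (g v) = dot I (f' u) (f' v)"
    using drop_coordinate[OF G d' perp i] p(2) by metis
  show "\<exists>n. card I = n + 1 \<and> decyclable G n"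
    using g unfolding decyclable_def by metis
  assume odd: "odd (card I)" and "\<And>u. u \<in> ?V \<Longrightarrow> dot I (f u) (f u) = 0"
  then have "dot I' (g u) (g u) = 0" if "u \<in> ?V" for u
    using that disj by (auto simp: iso dot' X_def)
  then have perp': "dot I' (\<lambda>_. 1) (g u) = 0" if "u \<in> ?V" for u
    using that by (simp add: dot_self)
  have "even (card I')" using odd g(2) by (metis even_plus_one_iff)
  then have ones: "dot I' (\<lambda>_. 1) (\<lambda>_. 1) = 0"
    using sum_of_ones[of I'] by (simp add: dot_def)
  have "I' \<noteq> {}"
  proof
    assume "I' = {}"
    then have "card I = 1" using g(2) by simp
    then have "I = {i}" using i(1) by (auto simp: card_1_singleton_iff)
    then show False using p(2) i(2) by (simp add: dot_def)
  qed
  then obtain k where "k \<in> I'" by blast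
  then obtain I'' h where "decycles G I'' h r'" "card I'' + 1 = card I'"
    using drop_coordinate[OF G g(1) perp' _ refl] ones by metis
  moreover have "card I = card I'' + 2" using calculation(2) g(2) by linarith
  ultimately show "\<exists>n. card I = n + 2 \<and> decyclable G n" unfolding decyclable_def by blast
qed

section \<open>A cyclic triple before a digraph\<close>

text \<open>Let \<open>a\<close>, \<open>b\<close>, \<open>c\<close>, in this order, be a triple whose dot products make it a cyclic
  triangle, and suppose that it originally dominated all of \<open>G\<close>. A vertex of \<open>G\<close> comes
  before \<open>a\<close> exactly if its product with \<open>f a\<close> is 1, and likewise for \<open>b\<close> and
  \<open>c\<close>. So the three vectors \<open>f a\<close>, \<open>f a + f b\<close> and \<open>f b + f c\<close> represent three
  consecutive intervals of the vertices of \<open>G\<close>. If one of these vectors has square 1, its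
  interval can be reversed. Otherwise the cyclic pattern forces the product of two neighbouring ones
  to be 1, and their intervals can be exchanged.\<close>

lemma decycles_beside_cyclic_triple:
  assumes G: "oriented_graph G" and d: "decycles G I f r"
    and abc: "(a, b) \<in> r" "(b, c) \<in> r"
      "dot I (f a) (f b) = dot I (f b) (f c)" "dot I (f a) (f c) \<noteq> dot I (f a) (f b)"
    and before: "\<And>x u. x \<in> {a, b, c} \<Longrightarrow> u \<in> pverts G \<Longrightarrow>
      dot I (f x) (f u) = of_bool ((u, x) \<in> r) \<and> ((u, x) \<in> r \<or> (x, u) \<in> r)"
  shows "(\<exists>n. card I = n + 1 \<and> decyclable G n) \<or> odd (card I) \<and> isotropically_decyclable G (card I)"
    and "odd (card I) \<Longrightarrow> (\<And>u. u \<in> pverts G \<union> {a, b, c} \<Longrightarrow> dot I (f u) (f u) = 0) \<Longrightarrow>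
      (\<exists>n. card I = n + 2 \<and> decyclable G n)"
proof -
  let ?V = "pverts G"
  have r: "strict_linear_order_on ?V r" "trans r" "irrefl r"
    using d by (auto simp: decycles_def strict_linear_order_on_def)
  note asym = strict_linear_order_asym[OF r(1)] and tr = transD[OF r(2)]
  define p where "p = f a"
  define q where "q = (\<lambda>i. f a i + f b i)"
  define s where "s = (\<lambda>i. f b i + f c i)"
  define P where "P = {u \<in> ?V. (u, a) \<in> r}"
  define Q where "Q = {u \<in> ?V. (a, u) \<in> r \<and> (u, b) \<in> r}"
  define S where "S = {u \<in> ?V. (b, u) \<in> r \<and> (u, c) \<in> r}"
  have p: "dot I p (f u) = of_bool (u \<in> P)" if "u \<in> ?V" for u
    using that before[of a u] by (simp add: p_def P_def)
  have ab: "(u, a) \<in> r \<Longrightarrow> (u, b) \<in> r" and bc: "(u, b) \<in> r \<Longrightarrow> (u, c) \<in> r" for u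
    using tr abc(1,2) by blast+
  have q: "dot I q (f u) = of_bool (u \<in> Q)" if "u \<in> ?V" for u
    using that before[of a u] before[of b u] ab[of u] asym[of a u]
    by (auto simp: q_def Q_def dot_add_left bit_add_self)
  have s: "dot I s (f u) = of_bool (u \<in> S)" if "u \<in> ?V" for u
    using that before[of b u] before[of c u] bc[of u] asym[of b u]
    by (auto simp: s_def S_def dot_add_left bit_add_self)
  have aV: "(u, a) \<in> r \<or> (a, u) \<in> r" "(u, b) \<in> r \<or> (b, u) \<in> r" if "u \<in> ?V" for u
    using before[of a u] before[of b u] that by auto
  have PQ: "P \<subseteq> ?V" "Q \<subseteq> ?V" "\<And>u v. u \<in> P \<Longrightarrow> v \<in> Q \<Longrightarrow> (u, v) \<in> r"
    "\<And>u v w. u \<in> P \<Longrightarrow> w \<in> Q \<Longrightarrow> v \<in> ?V \<Longrightarrow> (u, v) \<in> r \<Longrightarrow> (v, w) \<in> r \<Longrightarrow> v \<in> P \<union> Q"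
    and QS: "Q \<subseteq> ?V" "S \<subseteq> ?V" "\<And>u v. u \<in> Q \<Longrightarrow> v \<in> S \<Longrightarrow> (u, v) \<in> r"
    "\<And>u v w. u \<in> Q \<Longrightarrow> w \<in> S \<Longrightarrow> v \<in> ?V \<Longrightarrow> (u, v) \<in> r \<Longrightarrow> (v, w) \<in> r \<Longrightarrow> v \<in> Q \<union> S"
    using aV tr unfolding P_def Q_def S_def by blast+
  have conv: "\<And>u v w. u \<in> P \<Longrightarrow> w \<in> P \<Longrightarrow> v \<in> ?V \<Longrightarrow> (u, v) \<in> r \<Longrightarrow> (v, w) \<in> r \<Longrightarrow> v \<in> P"
    "\<And>u v w. u \<in> Q \<Longrightarrow> w \<in> Q \<Longrightarrow> v \<in> ?V \<Longrightarrow> (u, v) \<in> r \<Longrightarrow> (v, w) \<in> r \<Longrightarrow> v \<in> Q"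
    "\<And>u v w. u \<in> S \<Longrightarrow> w \<in> S \<Longrightarrow> v \<in> ?V \<Longrightarrow> (u, v) \<in> r \<Longrightarrow> (v, w) \<in> r \<Longrightarrow> v \<in> S"
    using tr unfolding P_def Q_def S_def by blast+
  have pq: "dot I p q = dot I p p + dot I (f a) (f b)"
    by (simp add: p_def q_def dot_add_right)
  have qs: "dot I q s = dot I (f a) (f b) + dot I (f a) (f c) + (dot I (f b) (f b) + dot I (f b) (f c))"
    by (simp only: q_def s_def dot_add_right dot_add_left add.assoc add.left_commute add.commute)
  have qq: "dot I q q = dot I (f a) (f a) + dot I (f b) (f b)"
    unfolding q_def dot_add_left dot_add_right dot_commute[of I "f b" "f a"]
    by (cases "dot I (f a) (f b)") (simp_all add: bit_add_self)
  have ss: "dot I s s = dot I (f b) (f b) + dot I (f c) (f c)"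
    unfolding s_def dot_add_left dot_add_right dot_commute[of I "f c" "f b"]
    by (cases "dot I (f b) (f c)") (simp_all add: bit_add_self)
  \<comment> \<open>with isotropic vectors the products are the dot products of \<open>a\<close>, \<open>b\<close> and of \<open>a\<close>, \<open>c\<close>, which differ\<close>
  have adjacent: "dot I p q = 1 \<or> dot I q s = 1" if "dot I p p = 0" "dot I q q = 0"
  proof -
    have "dot I (f b) (f b) = 0" using that qq by (simp add: p_def)
    then show ?thesis using pq qs that abc(3,4)
      by (cases "dot I (f a) (f b)"; cases "dot I (f a) (f c)") (auto simp: bit_add_self)
  qed
  show "(\<exists>n. card I = n + 1 \<and> decyclable G n) \<or> odd (card I) \<and> isotropically_decyclable G (card I)"
  proof (cases "dot I p p = 0 \<and> dot I q q = 0 \<and> dot I s s = 0")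
    case True
    then have sq: "dot I p p = 0" "dot I q q = 0" "dot I s s = 0" by auto
    have "\<exists>n. card I = n + 1 \<and> decyclable G n" if "dot I p q = 1"
      by (rule adjacent_isotropic_interval_vectors(1)[OF G d, of P Q p q])
        (fact PQ p q sq that)+
    moreover have "\<exists>n. card I = n + 1 \<and> decyclable G n" if "dot I q s = 1"
      by (rule adjacent_isotropic_interval_vectors(1)[OF G d, of Q S q s])
        (fact QS q s sq that)+
    ultimately show ?thesis using adjacent sq by blast
  next
    case False
    then consider "dot I p p = 1" | "dot I q q = 1" | "dot I s s = 1" by auto
    then show ?thesis
    proof cases
      case 1
      show ?thesis by (rule odd_interval_vector[OF G d, of P p]) (fact PQ conv p 1)+
    next
      case 2
      show ?thesis by (rule odd_interval_vector[OF G d, of Q q]) (fact QS conv q 2)+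
    next
      case 3
      show ?thesis by (rule odd_interval_vector[OF G d, of S s]) (fact QS conv s 3)+
    qed
  qed
  assume odd: "odd (card I)" and iso: "\<And>u. u \<in> ?V \<union> {a, b, c} \<Longrightarrow> dot I (f u) (f u) = 0"
  then have sq: "dot I p p = 0" "dot I q q = 0" "dot I s s = 0"
    by (simp_all add: p_def qq ss)
  have isoV: "\<And>u. u \<in> ?V \<Longrightarrow> dot I (f u) (f u) = 0" using iso by blast
  have "\<exists>n. card I = n + 2 \<and> decyclable G n" if "dot I p q = 1"
    by (rule adjacent_isotropic_interval_vectors(2)[OF G d, of P Q p q])
      (fact PQ p q sq odd isoV that)+
  moreover have "\<exists>n. card I = n + 2 \<and> decyclable G n" if "dot I q s = 1"
    by (rule adjacent_isotropic_interval_vectors(2)[OF G d, of Q S q s])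
      (fact QS q s sq odd isoV that)+
  ultimately show "\<exists>n. card I = n + 2 \<and> decyclable G n" using adjacent sq by blast
qed

section \<open>Joins over arbitrary index sets\<close>

text \<open>Arbitrary finite index sets allow the first or the last part to be removed without
  renumbering the others.\<close>

definition join :: "nat set \<Rightarrow> (nat \<Rightarrow> 'a pair_pre_digraph) \<Rightarrow> (nat \<times> 'a) pair_pre_digraph" where
  "join S D = \<lparr> pverts = (SIGMA i:S. pverts (D i)),
     parcs = {((i, x), (i, y)) | i x y. i \<in> S \<and> (x, y) \<in> parcs (D i)}
           \<union> {((i, x), (i', y)) | i i' x y.
                i \<in> S \<and> i' \<in> S \<and> i < i' \<and> x \<in> pverts (D i) \<and> y \<in> pverts (D i')} \<rparr>"

lemma kjoin_eq_join: "kjoin k D = join {1..k} D"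
  by (auto simp: kjoin_def join_def relabel_def image_iff map_prod_def)

lemma oriented_graph_join:
  assumes "finite S" "\<And>i. i \<in> S \<Longrightarrow> oriented_graph (D i)"
  shows "oriented_graph (join S D)"
proof -
  have D: "finite (pverts (D i))" "parcs (D i) \<subseteq> pverts (D i) \<times> pverts (D i)"
    "\<And>u. (u, u) \<notin> parcs (D i)" "\<And>u v. (u, v) \<in> parcs (D i) \<Longrightarrow> (v, u) \<notin> parcs (D i)"
    if "i \<in> S" for i
    using assms(2)[OF that] unfolding oriented_graph_iff by blast+
  have "finite (pverts (join S D))" using D(1) assms(1) by (auto simp: join_def)
  moreover have "parcs (join S D) \<subseteq> pverts (join S D) \<times> pverts (join S D)"
    using D(2) by (force simp: join_def)
  moreover have "u \<noteq> v \<and> (v, u) \<notin> parcs (join S D)" if "(u, v) \<in> parcs (join S D)" for u v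
  proof -
    obtain i x i' y where e: "u = (i, x)" "v = (i', y)" by (metis surj_pair)
    show ?thesis using that D(3)[of i x] D(4)[of i x y] unfolding e by (auto simp: join_def)
  qed
  ultimately show ?thesis unfolding oriented_graph_iff by blast
qed

lemma join_singleton: "join {j} D = relabel (Pair j) (D j)"
  by (auto simp: join_def relabel_def image_iff map_prod_def)

lemma inversion_number_pos_imp_not_acyclic:
  assumes "oriented_graph G" "inversion_number G > 0"
  shows "\<not> acyclic (parcs G)"
proof
  assume "acyclic (parcs G)"
  then have "decycling_family G []" by (simp add: decycling_family_def invert_family_def)
  then have "decyclable G 0" using decyclable_iff_decycling_family[OF assms(1)] by auto
  then show False using inversion_number_le[OF assms(1)] assms(2) by fastforce
qed

text \<open>Complete the digraph to a tournament that the same vectors turn into the order \<open>r\<close>. A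
  tournament without cyclic triangles is transitive, hence acyclic, and so are its subgraphs.\<close>

lemma cyclic_triple_exists:
  assumes G: "oriented_graph G" and d: "decycles G I f r" and cyc: "\<not> acyclic (parcs G)"
  obtains a b c where "a \<in> pverts G" "b \<in> pverts G" "c \<in> pverts G" "(a, b) \<in> r" "(b, c) \<in> r"
    "dot I (f a) (f b) = dot I (f b) (f c)" "dot I (f a) (f c) \<noteq> dot I (f a) (f b)"
proof (rule ccontr)
  let ?V = "pverts G" and ?d = "\<lambda>u v. dot I (f u) (f v)"
  note thesisI = that
  assume no: "\<not> thesis"
  have H: "\<not> ((a, b) \<in> r \<and> (b, c) \<in> r \<and> ?d a b = ?d b c \<and> ?d a c \<noteq> ?d a b)"
    if "a \<in> ?V" "b \<in> ?V" "c \<in> ?V" for a b c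
    using thesisI[of a b c] that no by blast
  have r: "trans r" "irrefl r" "total_on ?V r" "strict_linear_order_on ?V r"
    and rd: "\<And>u v. (u, v) \<in> parcs G \<Longrightarrow> (u, v) \<in> r \<longleftrightarrow> ?d u v = 0"
    using d by (auto simp: decycles_def strict_linear_order_on_def)
  note asym = strict_linear_order_asym[OF r(4)]
  define T where "T = {(u, v). u \<in> ?V \<and> v \<in> ?V \<and> u \<noteq> v \<and> ((u, v) \<in> r \<longleftrightarrow> ?d u v = 0)}"
  have tot: "(v, u) \<in> r \<longleftrightarrow> (u, v) \<notin> r" if "u \<in> ?V" "v \<in> ?V" "u \<noteq> v" for u v
    using that r(3) asym by (auto simp: total_on_def)
  have "trans T"
  proof (rule transI)
    fix x y z assume xyz: "(x, y) \<in> T" "(y, z) \<in> T"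
    then have V: "x \<in> ?V" "y \<in> ?V" "z \<in> ?V" and ne: "x \<noteq> y" "y \<noteq> z" by (auto simp: T_def)
    have xy: "(x, y) \<in> r \<longleftrightarrow> ?d x y = 0" and yz: "(y, z) \<in> r \<longleftrightarrow> ?d y z = 0"
      using xyz by (auto simp: T_def)
    have "x \<noteq> z" using xy yz tot[OF V(1,2) ne(1)] dot_commute[of I "f x" "f y"] by metis
    have c: "?d y x = ?d x y" "?d z y = ?d y z" "?d z x = ?d x z" by (simp_all add: dot_commute)
    note t = tot[OF V(1,2) ne(1)] tot[OF V(2,3) ne(2)] tot[OF V(1,3) \<open>x \<noteq> z\<close>]
    have tr: "\<not> ((x, y) \<in> r \<and> (y, z) \<in> r \<and> (x, z) \<notin> r)"
      "\<not> ((z, y) \<in> r \<and> (y, x) \<in> r \<and> (z, x) \<notin> r)"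
      using r(1) by (meson transD)+
    have "(x, z) \<in> r \<longleftrightarrow> ?d x z = 0"
      using H[OF V(1) V(2) V(3)] H[OF V(1) V(3) V(2)] H[OF V(2) V(1) V(3)] H[OF V(2) V(3) V(1)]
        H[OF V(3) V(1) V(2)] H[OF V(3) V(2) V(1)] xy yz t tr unfolding c
      by (cases "?d x y"; cases "?d y z"; cases "?d x z") simp_all
    then show "(x, z) \<in> T" using V \<open>x \<noteq> z\<close> by (simp add: T_def)
  qed
  moreover have "irrefl T" by (simp add: irrefl_def T_def)
  ultimately have "acyclic T" by (simp add: acyclic_irrefl)
  moreover have "parcs G \<subseteq> T" using G rd by (auto simp: T_def oriented_graph_iff)
  ultimately show False using cyc acyclic_subset by blast
qed

text \<open>Reversing all arcs exchanges the first and the last part of a join, so that it suffices to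
  study a triple that dominates the rest.\<close>

definition reverse_digraph :: "'a pair_pre_digraph \<Rightarrow> 'a pair_pre_digraph" where
  "reverse_digraph G = \<lparr> pverts = pverts G, parcs = (parcs G)\<inverse> \<rparr>"

lemma oriented_graph_reverse: "oriented_graph G \<Longrightarrow> oriented_graph (reverse_digraph G)"
  unfolding oriented_graph_iff reverse_digraph_def by auto

lemma decycles_reverse: "decycles G I f r \<Longrightarrow> decycles (reverse_digraph G) I f (r\<inverse>)"
  by (auto simp: decycles_def reverse_digraph_def strict_linear_order_on_def dot_commute
      irrefl_def)

lemma decyclable_reverse:
  "decyclable (reverse_digraph G) n \<longleftrightarrow> decyclable G n"
  "isotropically_decyclable (reverse_digraph G) n \<longleftrightarrow> isotropically_decyclable G n"
proof -
  have rev: "reverse_digraph (reverse_digraph G) = G" by (simp add: reverse_digraph_def)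
  have "decyclable G n \<Longrightarrow> decyclable (reverse_digraph G) n"
    "isotropically_decyclable G n \<Longrightarrow> isotropically_decyclable (reverse_digraph G) n"
    for G :: "'a pair_pre_digraph"
    using decycles_reverse[of G] unfolding decyclable_def isotropically_decyclable_def
    by (blast, metis reverse_digraph_def pair_pre_digraph.select_convs(1))
  from this[of G] this[of "reverse_digraph G"]
  show "decyclable (reverse_digraph G) n \<longleftrightarrow> decyclable G n"
    "isotropically_decyclable (reverse_digraph G) n \<longleftrightarrow> isotropically_decyclable G n"
    unfolding rev by blast+
qed

text \<open>The part \<open>D i\<close>, being first or last in the join, contains a cyclic triple that
  dominates, or is dominated by, everything else.\<close>

lemma decycles_join_remove:
  assumes S: "finite S" "i \<in> S" and oriented: "\<forall>i \<in> S. oriented_graph (D i)"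
    and extreme: "(\<forall>i' \<in> S - {i}. i < i') \<or> (\<forall>i' \<in> S - {i}. i' < i)"
    and cyc: "\<not> acyclic (parcs (D i))" and d: "decycles (join S D) I f r"
  shows "(\<exists>n. card I = n + 1 \<and> decyclable (join (S - {i}) D) n) \<or>
      odd (card I) \<and> isotropically_decyclable (join (S - {i}) D) (card I)"
    and "odd (card I) \<Longrightarrow> (\<And>u. u \<in> pverts (join S D) \<Longrightarrow> dot I (f u) (f u) = 0) \<Longrightarrow>
      \<exists>n. card I = n + 2 \<and> decyclable (join (S - {i}) D) n"
proof -
  let ?H = "join S D" and ?G = "join (S - {i}) D"
  have D: "oriented_graph (D i)" if "i \<in> S" for i using oriented that by blast
  have G: "oriented_graph ?G" using S D by (intro oriented_graph_join) auto
  have sub: "pverts ?G \<subseteq> pverts ?H" "parcs ?G \<subseteq> parcs ?H" by (auto simp: join_def)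
  have "decycles ?G I (f \<circ> id) (inv_image r id)"
    using d by (rule decycles_pullback) (use sub in auto)
  then have dG: "decycles ?G I f r" by (simp add: inv_image_def)
  have dD: "decycles (D i) I (f \<circ> Pair i) (inv_image r (Pair i))"
    using d by (rule decycles_pullback) (use S in \<open>auto simp: join_def inj_on_def\<close>)
  obtain a b c where abc: "a \<in> pverts (D i)" "b \<in> pverts (D i)" "c \<in> pverts (D i)"
      "((i, a), (i, b)) \<in> r" "((i, b), (i, c)) \<in> r"
      "dot I (f (i, a)) (f (i, b)) = dot I (f (i, b)) (f (i, c))"
      "dot I (f (i, a)) (f (i, c)) \<noteq> dot I (f (i, a)) (f (i, b))"
    using cyclic_triple_exists[OF D[OF S(2)] dD cyc] by (auto simp: in_inv_image)
  have r: "strict_linear_order_on (pverts ?H) r" "total_on (pverts ?H) r"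
    and rd: "\<And>u v. (u, v) \<in> parcs ?H \<Longrightarrow> (u, v) \<in> r \<longleftrightarrow> dot I (f u) (f v) = 0"
    using d by (auto simp: decycles_def strict_linear_order_on_def)
  have inH: "x \<in> pverts ?H" "x \<notin> pverts ?G" if "x \<in> {(i, a), (i, b), (i, c)}" for x
    using that abc(1-3) S(2) by (auto simp: join_def)
  have inG: "u \<in> pverts ?H" if "u \<in> pverts ?G" for u
    using that by (auto simp: join_def)
  have tot: "(u, x) \<in> r \<longleftrightarrow> (x, u) \<notin> r" if "x \<in> {(i, a), (i, b), (i, c)}" "u \<in> pverts ?G" for x u
  proof -
    have "u \<noteq> x" using that inH(2) by metis
    then show ?thesis
      using r(2) inH(1)[OF that(1)] inG[OF that(2)] strict_linear_order_asym[OF r(1)]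
      unfolding total_on_def by metis
  qed
  consider "\<forall>i' \<in> S - {i}. i < i'" | "\<forall>i' \<in> S - {i}. i' < i" using extreme by blast
  then have "((\<exists>n. card I = n + 1 \<and> decyclable ?G n) \<or>
      odd (card I) \<and> isotropically_decyclable ?G (card I)) \<and>
    (odd (card I) \<longrightarrow> (\<forall>u \<in> pverts ?H. dot I (f u) (f u) = 0) \<longrightarrow>
      (\<exists>n. card I = n + 2 \<and> decyclable ?G n))"
  proof cases
    case 1
    have before: "dot I (f x) (f u) = of_bool ((u, x) \<in> r) \<and> ((u, x) \<in> r \<or> (x, u) \<in> r)"
      if "x \<in> {(i, a), (i, b), (i, c)}" "u \<in> pverts ?G" for x u
    proof -
      have "(x, u) \<in> parcs ?H" using that 1 S(2) abc(1-3) by (auto simp: join_def)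
      then show ?thesis using rd tot[OF that] by auto
    qed
    note L = decycles_beside_cyclic_triple[OF G dG abc(4-7) before]
    show ?thesis using L(1) L(2) inH(1) inG by blast
  next
    case 2
    let ?R = "reverse_digraph ?G"
    have before: "dot I (f x) (f u) = of_bool ((u, x) \<in> r\<inverse>) \<and> ((u, x) \<in> r\<inverse> \<or> (x, u) \<in> r\<inverse>)"
      if "x \<in> {(i, c), (i, b), (i, a)}" "u \<in> pverts ?R" for x u
    proof -
      have x: "x \<in> {(i, a), (i, b), (i, c)}" and u: "u \<in> pverts ?G"
        using that by (auto simp: reverse_digraph_def)
      have "(u, x) \<in> parcs ?H" using x u 2 S(2) abc(1-3) by (auto simp: join_def)
      then show ?thesis using rd[of u x] tot[OF x u] dot_commute[of I "f x" "f u"] by auto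
    qed
    have rev: "((i, c), (i, b)) \<in> r\<inverse>" "((i, b), (i, a)) \<in> r\<inverse>"
      "dot I (f (i, c)) (f (i, b)) = dot I (f (i, b)) (f (i, a))"
      "dot I (f (i, c)) (f (i, a)) \<noteq> dot I (f (i, c)) (f (i, b))"
      using abc(4-7) by (simp_all add: dot_commute)
    note L = decycles_beside_cyclic_triple[OF oriented_graph_reverse[OF G] decycles_reverse[OF dG]
        rev before, unfolded decyclable_reverse]
    have "pverts ?R = pverts ?G" by (simp add: reverse_digraph_def)
    then show ?thesis using L(1) L(2) inH(1) inG by blast
  qed
  then show "(\<exists>n. card I = n + 1 \<and> decyclable ?G n) \<or>
      odd (card I) \<and> isotropically_decyclable ?G (card I)"
    and "odd (card I) \<Longrightarrow> (\<And>u. u \<in> pverts ?H \<Longrightarrow> dot I (f u) (f u) = 0) \<Longrightarrow>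
      \<exists>n. card I = n + 2 \<and> decyclable ?G n" by blast+
qed

section \<open>Upper bounds for joins\<close>

text \<open>Each part \<open>D i\<close> with \<open>i \<noteq> j\<close> needs a single set; its members receive the vector
  \<open>g i\<close>. Orthogonality of the \<open>g i\<close> to each other and to the vectors of \<open>D j\<close> keeps
  the parts from interfering, and the lexicographic order serves the join.\<close>

lemma decyclable_join:
  assumes S: "finite S" "j \<in> S" and D: "\<And>i. i \<in> S \<Longrightarrow> oriented_graph (D i)"
    and one: "\<And>i. i \<in> S - {j} \<Longrightarrow> decyclable (D i) 1"
    and d: "decycles (D j) I f r"
    and g: "\<And>i. i \<in> S - {j} \<Longrightarrow> dot I (g i) (g i) = 1"
      "\<And>i i'. i \<in> S - {j} \<Longrightarrow> i' \<in> S - {j} \<Longrightarrow> i \<noteq> i' \<Longrightarrow> dot I (g i) (g i') = 0"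
      "\<And>i x. i \<in> S - {j} \<Longrightarrow> x \<in> pverts (D j) \<Longrightarrow> dot I (g i) (f x) = 0"
  shows "decyclable (join S D) (card I)"
proof -
  have "\<exists>c q. strict_linear_order_on (pverts (D i)) q \<and>
      (\<forall>u v. (u, v) \<in> parcs (D i) \<longrightarrow> (u, v) \<in> q \<longleftrightarrow> c u * c v = (0 :: bit))" if i: "i \<in> S - {j}" for i
  proof -
    obtain K h q where h: "decycles (D i) K h q" "card K = 1"
      using one[OF i] unfolding decyclable_def by blast
    then obtain t where "K = {t}" by (auto simp: card_1_singleton_iff)
    then show ?thesis using h(1)
      by (intro exI[of _ "\<lambda>u. h u t"] exI[of _ q]) (auto simp: decycles_def dot_def)
  qed
  then obtain c q where q: "\<And>i. i \<in> S - {j} \<Longrightarrow> strict_linear_order_on (pverts (D i)) (q i)"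
    and c: "\<And>i u v. i \<in> S - {j} \<Longrightarrow> (u, v) \<in> parcs (D i) \<Longrightarrow>
        (u, v) \<in> q i \<longleftrightarrow> c i u * c i v = (0 :: bit)"
    by metis
  define F where "F w = (if fst w = j then f (snd w) else (\<lambda>t. c (fst w) (snd w) * g (fst w) t))"
    for w
  define Q where "Q i = (if i = j then r else q i)" for i
  define R where "R = {((i, x), (i', y)) | i i' x y.
      i \<in> S \<and> i' \<in> S \<and> (i < i' \<or> i = i' \<and> (x, y) \<in> Q i)}"
  have dj: "finite I" "strict_linear_order_on (pverts (D j)) r"
    "\<And>u v. (u, v) \<in> parcs (D j) \<Longrightarrow> (u, v) \<in> r \<longleftrightarrow> dot I (f u) (f v) = 0"
    using d by (auto simp: decycles_def)
  have Q: "trans (Q i)" "irrefl (Q i)" "total_on (pverts (D i)) (Q i)" if "i \<in> S" for i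
    using q[of i] dj(2) that by (auto simp: Q_def strict_linear_order_on_def)
  have cross: "dot I (F (i, x)) (F (i', y)) = 0"
    if "i \<in> S" "i' \<in> S" "i \<noteq> i'" "x \<in> pverts (D i)" "y \<in> pverts (D i')" for i i' x y
    using that g(2)[of i i'] g(3)[of i y] g(3)[of i' x]
    by (auto simp: F_def dot_scaled_left dot_scaled_right dot_commute[of I "f x"])
  have within: "(x, y) \<in> Q i \<longleftrightarrow> dot I (F (i, x)) (F (i, y)) = 0"
    if "i \<in> S" "(x, y) \<in> parcs (D i)" for i x y
    using that c[of i x y] dj(3)[of x y] g(1)[of i]
    by (auto simp: F_def Q_def dot_scaled_left dot_scaled_right)
  have "trans R"
  proof (rule transI)
    fix u v w assume uvw: "(u, v) \<in> R" "(v, w) \<in> R"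
    obtain i x i' y i'' z where e: "u = (i, x)" "v = (i', y)" "w = (i'', z)"
      by (metis surj_pair)
    show "(u, w) \<in> R"
      using uvw Q(1)[of i, THEN transD, of x y z] unfolding e by (auto simp: R_def)
  qed
  moreover have "irrefl R" using Q(2) by (auto simp: R_def irrefl_def)
  moreover have "total_on (pverts (join S D)) R"
  proof (rule total_onI)
    fix u v assume uv: "u \<in> pverts (join S D)" "v \<in> pverts (join S D)" "u \<noteq> v"
    obtain i x i' y where e: "u = (i, x)" "v = (i', y)" by (metis surj_pair)
    show "(u, v) \<in> R \<or> (v, u) \<in> R"
      using uv Q(3)[of i, unfolded total_on_def, rule_format, of x y] unfolding e by (auto simp: R_def join_def)
  qed
  moreover have "\<forall>(u, v) \<in> parcs (join S D). (u, v) \<in> R \<longleftrightarrow> dot I (F u) (F v) = 0"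
    using cross within by (auto simp: join_def R_def)
  ultimately have "decycles (join S D) I F R"
    using dj(1) by (auto simp: decycles_def strict_linear_order_on_def)
  then show ?thesis unfolding decyclable_def by blast
qed

text \<open>Every index in \<open>A\<close> gets a new coordinate of its own. An index \<open>h\<close> left out
  gets the all-one vector on the coordinates of \<open>D j\<close>: oddness makes its square 1, and isotropy
  makes it orthogonal to the vectors of \<open>D j\<close>.\<close>

lemma decyclable_join_padded:
  assumes S: "finite S" "j \<in> S" and D: "\<And>i. i \<in> S \<Longrightarrow> oriented_graph (D i)"
    and one: "\<And>i. i \<in> S - {j} \<Longrightarrow> decyclable (D i) 1"
    and d: "decycles (D j) I f r"
    and A: "A = S - {j} \<or> (\<exists>h \<in> S - {j}. A = S - {j, h}) \<and> odd (card I) \<and>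
      (\<forall>u \<in> pverts (D j). dot I (f u) (f u) = 0)"
  shows "decyclable (join S D) (card I + card A)"
proof -
  have I: "finite I" using d by (simp add: decycles_def)
  then obtain N where N: "\<And>t. t \<in> I \<Longrightarrow> t < N" by (auto simp: finite_nat_set_iff_bounded)
  have A': "finite A" "A \<subseteq> S - {j}" using A S(1) by auto
  \<comment> \<open>\<open>N\<close> bounds the old coordinates, so that \<open>N + i\<close> is new\<close>
  define I' where "I' = I \<union> (+) N ` A"
  have I': "finite I'" "I \<subseteq> I'" using I A'(1) by (auto simp: I'_def)
  have "I \<inter> (+) N ` A = {}" using N by fastforce
  then have card: "card I' = card I + card A"
    using I A'(1) by (simp add: I'_def card_Un_disjoint card_image)
  define g where "g i t = (if i \<in> A then of_bool (t = N + i) else of_bool (t \<in> I) :: bit)" for i t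
  define f' where "f' u t = (if t \<in> I then f u t else 0)" for u t
  have restrict: "dot I' x y = dot I x y" if "\<And>t. t \<notin> I \<Longrightarrow> x t = 0" for x y
    unfolding dot_def using I' that by (intro sum.mono_neutral_right) auto
  have unit: "dot I' (g i) y = y (N + i)" if "i \<in> A" for i y
  proof -
    have "dot I' (g i) y = (\<Sum>t\<in>I'. if t = N + i then y t else 0)"
      unfolding dot_def g_def using that by (intro sum.cong) auto
    then show ?thesis using that I' by (simp add: I'_def)
  qed
  have ones: "dot I' (g i) y = dot I (\<lambda>_. 1) y" if "i \<notin> A" for i y
    using that restrict[of "g i" y] by (simp add: g_def dot_def)
  have f': "dot I' (f' u) (f' v) = dot I (f u) (f v)" for u v
    using restrict[of "f' u" "f' v"] by (simp add: f'_def dot_def)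
  have d': "decycles (D j) I' f' r" using d I' by (simp add: decycles_def f')
  have g1: "dot I' (g i) (g i) = 1" if "i \<in> S - {j}" for i
  proof (cases "i \<in> A")
    case True
    then show ?thesis by (simp add: unit) (simp add: g_def)
  next
    case False
    then have "odd (card I)" using that A by blast
    then show ?thesis using False sum_of_ones[of I] by (simp add: ones) (simp add: dot_def g_def)
  qed
  have g2: "dot I' (g i) (g i') = 0" if "i \<in> S - {j}" "i' \<in> S - {j}" "i \<noteq> i'" for i i'
  proof (cases "i \<in> A")
    case True
    then show ?thesis using that(3) N[of "N + i"] by (simp add: unit) (auto simp: g_def)
  next
    case False
    then have "i' \<in> A" using that A by blast
    then show ?thesis using False that(3) N[of "N + i'"]
      by (simp add: dot_commute[of _ "g i" "g i'"] unit) (auto simp: g_def)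
  qed
  have g3: "dot I' (g i) (f' u) = 0" if "i \<in> S - {j}" "u \<in> pverts (D j)" for i u
  proof (cases "i \<in> A")
    case True
    then show ?thesis using N[of "N + i"] by (auto simp: unit f'_def)
  next
    case False
    then have "dot I (f u) (f u) = 0" using that A by blast
    then show ?thesis using False by (simp add: ones dot_self) (simp add: dot_def f'_def)
  qed
  have "decyclable (join S D) (card I')"
    by (rule decyclable_join[of S j D I' f' r g]) (fact S D one d' g1 g2 g3)+
  then show ?thesis by (simp add: card)
qed

lemma inversion_number_join_le:
  assumes S: "finite S" "j \<in> S" "2 \<le> card S" and D: "\<And>i. i \<in> S \<Longrightarrow> oriented_graph (D i)"
    and one: "\<And>i. i \<in> S - {j} \<Longrightarrow> inversion_number (D i) = 1"
  shows "inversion_number (join S D) + of_bool (critical (D j)) + 1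
    \<le> inversion_number (D j) + card S"
proof -
  let ?m = "inversion_number (D j)"
  have J: "oriented_graph (join S D)" using oriented_graph_join S(1) D by blast
  have one': "decyclable (D i) 1" if "i \<in> S - {j}" for i
    using decyclable_inversion_number[of "D i"] D one[OF that] that by simp
  show ?thesis
  proof (cases "critical (D j)")
    case True
    then obtain I f r where d: "decycles (D j) I f r" "card I = ?m" "odd ?m"
      "\<forall>u \<in> pverts (D j). dot I (f u) (f u) = 0"
      unfolding critical_def isotropically_decyclable_def by blast
    have "S - {j} \<noteq> {}" using S by (metis One_nat_def card.empty card_Suc_Diff1 not_less_eq_eq
          numeral_2_eq_2 order_refl)
    then obtain h where h: "h \<in> S - {j}" by blast
    have "decyclable (join S D) (card I + card (S - {j, h}))"
      by (rule decyclable_join_padded[of S j D I f r]) (use S D one' d h in auto)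
    moreover have "card (S - {j, h}) = card S - 2" using h S by (simp add: card_Diff_subset)
    ultimately have "inversion_number (join S D) \<le> ?m + (card S - 2)"
      using inversion_number_le[OF J] d(2) by simp
    then show ?thesis using True S(3) by simp
  next
    case False
    obtain I f r where d: "decycles (D j) I f r" "card I = ?m"
      using decyclable_inversion_number[OF D[OF S(2)]] unfolding decyclable_def by blast
    have "decyclable (join S D) (card I + card (S - {j}))"
      by (rule decyclable_join_padded[of S j D I f r]) (use S D one' d in auto)
    then have "inversion_number (join S D) \<le> ?m + (card S - 1)"
      using inversion_number_le[OF J] d(2) S by simp
    then show ?thesis using False S(3) by simp
  qed
qed

section \<open>The inversion number of a join\<close>

text \<open>The induction removes an extreme part other than \<open>D j\<close>. By
  \<open>decycles_join_remove\<close>, adding a part to a digraph that is not critical costs at least one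
  inversion, and adding it to a critical one may be free. The statement that joins with at least two
  parts are never critical is proved along with the formula, so that at most the first added part is
  free. It holds because removing a part from a critical join would save two inversions, whereas the
  upper bound allows only one.\<close>

lemma inversion_number_join:
  assumes "finite S" "j \<in> S" "2 \<le> card S" "\<And>i. i \<in> S \<Longrightarrow> oriented_graph (D i)"
    and "\<And>i. i \<in> S - {j} \<Longrightarrow> inversion_number (D i) = 1"
  shows "inversion_number (join S D) + of_bool (critical (D j)) + 1
      = inversion_number (D j) + card S \<and> \<not> critical (join S D)"
  using assms
proof (induction "card S" arbitrary: S rule: less_induct)
  case less
  note S = less.prems(1-3) and D = less.prems(4) and one = less.prems(5)
  let ?m = "inversion_number (D j)" and ?\<kappa> = "of_bool (critical (D j)) :: nat"
  have "S \<noteq> {}" using S(2) by blast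
  obtain i where i: "i \<in> S" "i \<noteq> j" "(\<forall>i' \<in> S - {i}. i < i') \<or> (\<forall>i' \<in> S - {i}. i' < i)"
  proof (cases "Max S = j")
    case True
    have "Min S \<noteq> j"
    proof
      assume "Min S = j"
      then have "S \<subseteq> {j}" using True S(1) by (metis Max_ge Min_le dual_order.antisym insertI1 subsetI)
      then show False using S(3) card_mono[of "{j}" S] by simp
    qed
    moreover have "Min S \<in> S" "\<forall>i' \<in> S - {Min S}. Min S < i'"
      using S(1) \<open>S \<noteq> {}\<close> by (auto simp: order_less_le)
    ultimately show ?thesis using that by blast
  next
    case False
    have "Max S \<in> S" "\<forall>i' \<in> S - {Max S}. i' < Max S"
      using S(1) \<open>S \<noteq> {}\<close> by (auto simp: order_less_le)
    then show ?thesis using that False by blast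
  qed
  let ?S = "S - {i}"
  let ?n = "inversion_number (join S D)" and ?n' = "inversion_number (join ?S D)"
  have H: "oriented_graph (join S D)" and G: "oriented_graph (join ?S D)"
    using S(1) D by (auto intro!: oriented_graph_join)
  have cS: "card S = card ?S + 1" using S(1) i(1) by (metis Suc_eq_plus1 card_Suc_Diff1)
  have cyc: "\<not> acyclic (parcs (D i))"
    using inversion_number_pos_imp_not_acyclic[OF D[OF i(1)]] one[of i] i by simp
  have sub: "(card ?S = 1 \<and> ?n' = ?m \<and> (critical (join ?S D) \<longleftrightarrow> critical (D j))) \<or>
      (?n' + ?\<kappa> + 1 = ?m + card ?S \<and> \<not> critical (join ?S D))"
  proof (cases "card ?S = 1")
    case True
    moreover have "j \<in> ?S" using i(2) S(2) by blast
    ultimately have "?S = {j}" by (metis card_1_singletonE singletonD)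
    then show ?thesis
      using True relabel_invariant[OF D[OF S(2)], of "Pair j"] by (simp add: join_singleton inj_def)
  next
    case False
    then have two: "2 \<le> card ?S" using cS S(3) by linarith
    have "?n' + ?\<kappa> + 1 = ?m + card ?S \<and> \<not> critical (join ?S D)"
    proof (rule less.hyps)
      show "card ?S < card S" "finite ?S" "j \<in> ?S" using cS S i(2) by auto
      show "oriented_graph (D i')" if "i' \<in> ?S" for i' using that D by blast
      show "inversion_number (D i') = 1" if "i' \<in> ?S - {j}" for i' using that one by blast
    qed (rule two)
    then show ?thesis ..
  qed
  have "\<forall>i \<in> S. oriented_graph (D i)" using D by blast
  note remove = decycles_join_remove[OF S(1) i(1) this i(3) cyc]
  have le: "?n + ?\<kappa> + 1 \<le> ?m + card S" using S D one by (rule inversion_number_join_le)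
  have ge: "?n' + 1 \<le> ?n \<or> ?n' = ?n \<and> critical (join ?S D)"
  proof -
    obtain I f r where d: "decycles (join S D) I f r" "card I = ?n"
      using decyclable_inversion_number[OF H] unfolding decyclable_def by blast
    from remove(1)[OF d(1)] consider n where "?n = n + 1" "decyclable (join ?S D) n"
      | "odd ?n" "isotropically_decyclable (join ?S D) ?n"
      unfolding d(2) by blast
    then show ?thesis
    proof cases
      case 1
      then show ?thesis using inversion_number_le[OF G 1(2)] by simp
    next
      case 2
      have "?n' \<le> ?n"
        using inversion_number_le[OF G isotropically_decyclable_imp_decyclable[OF 2(2)]] .
      then show ?thesis using 2 by (cases "?n' = ?n") (auto simp: critical_def)
    qed
  qed
  have eq: "?n + ?\<kappa> + 1 = ?m + card S"
    using le ge sub cS by (auto split: if_splits)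
  moreover have "\<not> critical (join S D)"
  proof
    assume "critical (join S D)"
    then obtain I f r where d: "decycles (join S D) I f r" "card I = ?n" "odd (card I)"
      "\<And>u. u \<in> pverts (join S D) \<Longrightarrow> dot I (f u) (f u) = 0"
      unfolding critical_def isotropically_decyclable_def by metis
    obtain n where "?n = n + 2" "decyclable (join ?S D) n"
      using remove(2)[OF d(1,3,4)] d(2) by metis
    then have "?n' + 2 \<le> ?n" using inversion_number_le[OF G] by fastforce
    then show False using eq sub cS by (auto split: if_splits)
  qed
  ultimately show ?case by blast
qed

lemma inversion_number_C3: "inversion_number C3 = 1"
proof -
  have C3_arcs: "(0, 1) \<in> parcs C3" "(1, 2) \<in> parcs C3" "(2, 0) \<in> parcs C3"
    by (simp_all add: C3_def)
  have fam: "decycling_family C3 [{0, 1}]"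
  proof -
    have "parcs (invert_family [{0, 1}] C3) = {(1, 0), (1, 2), (2, 0)}"
      by (auto simp: invert_family_def invert_def C3_def)
    \<comment> \<open>the measure puts 1 before 2 and 2 before 0\<close>
    moreover have "{(1, 0), (1, 2), (2, 0)} \<subseteq> measure (\<lambda>v::nat. (v + 2) mod 3)"
      by auto
    ultimately have "acyclic (parcs (invert_family [{0, 1}] C3))"
      by (metis acyclic_subset wf_acyclic wf_measure)
    then show ?thesis by (simp add: decycling_family_def C3_def)
  qed
  then have "inversion_number C3 \<le> 1"
    unfolding inversion_number_def by (intro Least_le) auto
  moreover have "inversion_number C3 \<noteq> 0"
  proof
    assume "inversion_number C3 = 0"
    then have "decyclable C3 0" using decyclable_inversion_number[OF oriented_graph_C3] by simp
    then have "acyclic (parcs C3)"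
      using decyclable_iff_decycling_family[OF oriented_graph_C3, of 0]
      by (auto simp: decycling_family_def invert_family_def)
    moreover have "(0, 0) \<in> (parcs C3)\<^sup>+"
      by (meson C3_arcs r_into_trancl trancl_into_trancl)
    ultimately show False by (simp add: acyclic_def)
  qed
  ultimately show ?thesis by simp
qed

text \<open>The dijoin with \<open>C3\<close> is itself a join of two parts, one of which has inversion number
  1, so that the formula for joins identifies the case distinction by \<open>C3\<close> with criticality.\<close>

lemma inversion_number_dijoin_C3:
  assumes G: "oriented_graph G"
  shows "inversion_number (dijoin C3 G) = inversion_number G \<longleftrightarrow> critical G"
proof -
  define D where "D i = (if i = 1 then relabel Inl C3 else relabel Inr G)" for i :: nat
  have D1: "D 1 = relabel Inl C3" and D2: "D 2 = relabel Inr G" by (simp_all add: D_def)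
  have "inversion_number (join {1..2} D) + of_bool (critical (D 2)) + 1
      = inversion_number (D 2) + card {1..2::nat} \<and> \<not> critical (join {1..2} D)"
  proof (rule inversion_number_join)
    show "oriented_graph (D i)" for i
      unfolding D_def using G oriented_graph_C3 by (auto intro: oriented_graph_relabel)
    show "inversion_number (D i) = 1" if "i \<in> {1..2} - {2}" for i
    proof -
      have "i = 1" using that by auto
      then show ?thesis
        using relabel_invariant(1)[OF oriented_graph_C3, of Inl] D1 by (simp add: inversion_number_C3)
    qed
  qed auto
  moreover have "dijoin C3 G = join {1..2} D"
    by (simp only: dijoin_def kjoin_eq_join D_def[abs_def])
  moreover have "inversion_number (D 2) = inversion_number G" "critical (D 2) \<longleftrightarrow> critical G"
    using relabel_invariant[OF G, of Inr] D2 by simp_all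
  ultimately show ?thesis by (cases "critical G") simp_all
qed

theorem corollary1p10:
  fixes k j :: nat and D :: "nat \<Rightarrow> 'a pair_pre_digraph"
  assumes "k \<ge> 2"
    and "\<And>i. i \<in> {1..k} \<Longrightarrow> oriented_graph (D i)"
    and "j \<in> {1..k}"
    and "inversion_number (D j) \<ge> 1"
    and "\<And>i. i \<in> {1..k} - {j} \<Longrightarrow> inversion_number (D i) = 1"
  shows "inversion_number (kjoin k D) =
    (if inversion_number (dijoin C3 (D j)) = inversion_number (D j)
     then (\<Sum>i = 1..k. inversion_number (D i)) - 1
     else (\<Sum>i = 1..k. inversion_number (D i)))"
proof -
  have "inversion_number (kjoin k D) + of_bool (critical (D j)) + 1 = inversion_number (D j) + k"
    using inversion_number_join[of "{1..k}" j D] assms by (simp add: kjoin_eq_join)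
  moreover have "(\<Sum>i = 1..k. inversion_number (D i)) = inversion_number (D j) + (k - 1)"
  proof -
    have "(\<Sum>i \<in> {1..k} - {j}. inversion_number (D i)) = (\<Sum>i \<in> {1..k} - {j}. 1)"
      using assms(5) by (rule sum.cong[OF refl])
    also have "\<dots> = k - 1" using assms(3) by simp
    finally show ?thesis
      using sum.remove[of "{1..k}" j "\<lambda>i. inversion_number (D i)"] assms(3) by simp
  qed
  ultimately show ?thesis
    using assms(1) inversion_number_dijoin_C3[OF assms(2)[OF assms(3)]] by (auto split: if_splits)
qed

end
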